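(* For every integer $n\ge 1$, the minimum number of days in which a rook can survey the $n\times n$ board is $n$.
   Context: Cells of the $n\times n$ board are $(x,y)$ with $1\le x,y\le n$. A rook can move from a cell to any other cell having the same $x$-coordinate or the same $y$-coordinate. A survey of the board in $m$ days by a piece is a sequence of cells $p_1,\dots,p_m$ such that for each $i<m$ the piece can move from $p_i$ to $p_{i+1}$ in one move, and every cell of the board either equals some $p_i$ or can be reached in one move of the piece from some $p_i$. The starting cell $p_1$ can be chosen freely. *)

theory Defs
  imports Main
begin

type_synonym cell = "nat \<times> nat"

definition board :: "nat \<Rightarrow> cell set" where
  "board n = {1..n} \<times> {1..n}"

definition rook_move :: "cell \<Rightarrow> cell \<Rightarrow> bool" where
  "rook_move p q \<longleftrightarrow> p \<noteq> q \<and> (fst p = fst q \<or> snd p = snd q)"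

(* A piece is given by its relation "can move from p to q in one move".
   The list of cells holds one cell per day, so the number of days is its length. *)
definition survey :: "(cell \<Rightarrow> cell \<Rightarrow> bool) \<Rightarrow> nat \<Rightarrow> cell list \<Rightarrow> bool" where
  "survey move n ps \<longleftrightarrow>
     set ps \<subseteq> board n \<and>
     successively move ps \<and>
     (\<forall>c \<in> board n. \<exists>p \<in> set ps. c = p \<or> move p c)"

definition can_survey_in :: "(cell \<Rightarrow> cell \<Rightarrow> bool) \<Rightarrow> nat \<Rightarrow> nat \<Rightarrow> bool" where
  "can_survey_in move n m \<longleftrightarrow> (\<exists>ps. length ps = m \<and> survey move n ps)"

(* Attainment is part of the definition, so it never holds for a board without a survey. *)
definition is_min_survey_days :: "(cell \<Rightarrow> cell \<Rightarrow> bool) \<Rightarrow> nat \<Rightarrow> nat \<Rightarrow> bool" where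
  "is_min_survey_days move n m \<longleftrightarrow>
     can_survey_in move n m \<and> (\<forall>k. can_survey_in move n k \<longrightarrow> m \<le> k)"

end

theory Submission
  imports Defs
begin

text \<open>
  Walking along a single line of the board takes \<open>n\<close> days, and the visited cells meet every
  line of the other direction, so everything is surveyed. Fewer days do not suffice: the cells
  surveyed from \<open>(a, b)\<close> are those on the two lines through \<open>(a, b)\<close>, so if some
  \<open>x\<close> is missing among the first coordinates of the visited cells and some \<open>y\<close> among
  the second ones, then the cell \<open>(x, y)\<close> is missed. Hence the visited cells exhaust
  \<open>{1..n}\<close> in one of the two coordinates, which takes at least \<open>n\<close> of them.
\<close>

lemma survey_along_line: "survey rook_move n (map (Pair 1) [1..<Suc n])"
  by (auto simp: survey_def board_def rook_move_def successively_conv_nth simp del: upt_Suc)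

lemma rook_survey_exhausts_coordinate:
  assumes "survey rook_move n ps"
  shows "{1..n} \<subseteq> fst ` set ps \<or> {1..n} \<subseteq> snd ` set ps"
proof (rule ccontr)
  assume "\<not> ?thesis"
  then obtain x y where "x \<in> {1..n}" "x \<notin> fst ` set ps" "y \<in> {1..n}" "y \<notin> snd ` set ps"
    by blast
  then have "(x, y) \<in> board n"
    by (simp add: board_def)
  with assms obtain p where "p \<in> set ps" "(x, y) = p \<or> rook_move p (x, y)"
    unfolding survey_def by blast
  then have "fst p = x \<or> snd p = y"
    by (auto simp: rook_move_def)
  with \<open>p \<in> set ps\<close> \<open>x \<notin> fst ` set ps\<close> \<open>y \<notin> snd ` set ps\<close> show False
    by blast
qed

theorem mainTheorem4:
  fixes n :: nat
  assumes "n \<ge> 1"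
  shows "is_min_survey_days rook_move n n"
proof -
  have "n \<le> length ps" if "survey rook_move n ps" for ps
  proof -
    have bound: "n \<le> length ps" if "{1..n} \<subseteq> f ` set ps" for f :: "cell \<Rightarrow> nat"
      using surj_card_le[OF _ that] card_length[of ps] by simp
    show ?thesis
      using rook_survey_exhausts_coordinate[OF \<open>survey rook_move n ps\<close>] bound by blast
  qed
  moreover have "can_survey_in rook_move n n"
    using survey_along_line[of n] unfolding can_survey_in_def
    by (intro exI[of _ "map (Pair 1) [1..<Suc n]"]) simp
  ultimately show ?thesis
    by (auto simp: is_min_survey_days_def can_survey_in_def)
qed

end
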